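(* Let $(A,\oplus)$ be a ccm-magma with a subalgebra $X\subseteq A$ and an idempotent element $e\in X$ ($e\oplus e=e$). Consider the relation $R$ on $A$ defined by \[aRb\Leftrightarrow \exists x\in X,\ a\oplus e=x\oplus b.\] Then $R$: (i) is an internal relation; (ii) is reflexive; (iii) is transitive whenever $X$ has a (necessarily unique) internal monoid structure with $e\in X$ as its unit; (iv) is symmetric if and only if $X$ is $e$-symmetric.
   Context: A ccm-magma (commutative cancellative medial magma) is a set $A$ with a binary operation $\oplus$ such that for all $a,b,c,d\in A$: (M1) $a\oplus b=b\oplus a$; (M2) $a\oplus c=b\oplus c$ implies $a=b$; (M3) $(a\oplus b)\oplus(c\oplus d)=(a\oplus c)\oplus(b\oplus d)$. A subalgebra is a subset closed under $\oplus$; it is itself a ccm-magma. An internal relation on $A$ is a subalgebra of $A\times A$ (with componentwise operation). An internal monoid structure on a ccm-magma $(X,\oplus)$ with unit $e$ is a monoid structure on the set $X$ with some operation $*_e$ and unit $e$ that is compatible with $\oplus$, i.e. $(x*_e y)\oplus(z*_e w)=(x\oplus z)*_e(y\oplus w)$ for all $x,y,z,w\in X$. A ccm-magma $X$ is $e$-symmetric (for $e\in X$) if for every $a\in X$ there exists $-_e(a)\in X$ with $-_e(a)\oplus a=e$. *)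

theory Defs
  imports "HOL-Algebra.Group"
begin

locale ccm_magma =
  fixes A :: "'a set" and oplus :: "'a \<Rightarrow> 'a \<Rightarrow> 'a" (infixl \<open>\<oplus>\<close> 65)
  assumes closed: "\<lbrakk>a \<in> A; b \<in> A\<rbrakk> \<Longrightarrow> a \<oplus> b \<in> A"
    and commute: "\<lbrakk>a \<in> A; b \<in> A\<rbrakk> \<Longrightarrow> a \<oplus> b = b \<oplus> a"
    and cancel: "\<lbrakk>a \<in> A; b \<in> A; c \<in> A; a \<oplus> c = b \<oplus> c\<rbrakk> \<Longrightarrow> a = b"
    and medial: "\<lbrakk>a \<in> A; b \<in> A; c \<in> A; d \<in> A\<rbrakk>
      \<Longrightarrow> (a \<oplus> b) \<oplus> (c \<oplus> d) = (a \<oplus> c) \<oplus> (b \<oplus> d)"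

definition subalgebra :: "'a set \<Rightarrow> ('a \<Rightarrow> 'a \<Rightarrow> 'a) \<Rightarrow> 'a set \<Rightarrow> bool" where
  "subalgebra A f X \<longleftrightarrow> X \<subseteq> A \<and> (\<forall>x\<in>X. \<forall>y\<in>X. f x y \<in> X)"

definition componentwise :: "('a \<Rightarrow> 'a \<Rightarrow> 'a) \<Rightarrow> 'a \<times> 'a \<Rightarrow> 'a \<times> 'a \<Rightarrow> 'a \<times> 'a" where
  "componentwise f p q = (f (fst p) (fst q), f (snd p) (snd q))"

definition internal_relation :: "'a set \<Rightarrow> ('a \<Rightarrow> 'a \<Rightarrow> 'a) \<Rightarrow> ('a \<times> 'a) set \<Rightarrow> bool" where
  "internal_relation A f R \<longleftrightarrow> subalgebra (A \<times> A) (componentwise f) R"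

text \<open>Only the values of \<^term>\<open>m\<close> on \<^term>\<open>X\<close> are constrained, so two internal monoid structures
  are the same when they agree on \<^term>\<open>X\<close>.\<close>

definition internal_monoid ::
    "'a set \<Rightarrow> ('a \<Rightarrow> 'a \<Rightarrow> 'a) \<Rightarrow> 'a \<Rightarrow> ('a \<Rightarrow> 'a \<Rightarrow> 'a) \<Rightarrow> bool" where
  "internal_monoid X f e m \<longleftrightarrow>
     monoid \<lparr>carrier = X, mult = m, one = e\<rparr> \<and>
     (\<forall>x\<in>X. \<forall>y\<in>X. \<forall>z\<in>X. \<forall>w\<in>X. f (m x y) (m z w) = m (f x z) (f y w))"

definition e_symmetric :: "'a set \<Rightarrow> ('a \<Rightarrow> 'a \<Rightarrow> 'a) \<Rightarrow> 'a \<Rightarrow> bool" where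
  "e_symmetric X f e \<longleftrightarrow> (\<forall>a\<in>X. \<exists>b\<in>X. f b a = e)"

end

theory Submission
  imports Defs
begin

text \<open>
  Translation by the idempotent \<open>e\<close> is an injective endomorphism of \<open>A\<close>: mediality with
  \<open>e = e \<oplus> e\<close> gives \<open>(a \<oplus> b) \<oplus> e = (a \<oplus> e) \<oplus> (b \<oplus> e)\<close>, and cancellation gives injectivity. So an
  identity may be proved after adding \<open>e\<close> to both sides, and mediality can then rearrange the four
  resulting terms. One should think of \<open>u \<oplus> v\<close> as an average such as \<open>(u + v) / 2\<close> in a module with
  origin \<open>e\<close>; then \<open>a R b\<close> says that the difference \<open>a - b\<close> lies in \<open>X\<close>.

  Under this reading the sum \<open>x + y\<close> is the solution \<open>z\<close> of \<open>z \<oplus> e = x \<oplus> y\<close>. An interchange argument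
  in the style of Eckmann and Hilton (\<open>internal_monoid_product\<close>) shows that the product of every
  internal monoid on \<open>X\<close> with unit \<open>e\<close> is this sum. Hence the product is unique. If it exists, \<open>X\<close> is closed under sums, and
  \<open>R\<close> is transitive because \<open>a - c = (a - b) + (b - c)\<close>. Likewise a solution \<open>z\<close> of \<open>z \<oplus> x = e\<close> is the negative of
  \<open>x\<close>, so symmetry of \<open>R\<close> follows from closure of \<open>X\<close> under negatives; conversely, every
  element of \<open>X\<close> is related to \<open>e\<close>, and reversing that pair produces its negative.
  Because \<open>X\<close> is closed under \<open>\<oplus>\<close>, averages of differences stay in \<open>X\<close>, which makes \<open>R\<close> internal.
\<close>

text \<open>The pairs whose difference, measured from the origin \<open>e\<close>, lies in \<open>X\<close>.\<close>

definition difference_relation ::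
    "'a set \<Rightarrow> ('a \<Rightarrow> 'a \<Rightarrow> 'a) \<Rightarrow> 'a \<Rightarrow> 'a set \<Rightarrow> ('a \<times> 'a) set" where
  "difference_relation A f e X = {(a, b). a \<in> A \<and> b \<in> A \<and> (\<exists>x\<in>X. f a e = f x b)}"

lemma difference_relationI:
  assumes "a \<in> A" "b \<in> A" "x \<in> X" "f a e = f x b"
  shows "(a, b) \<in> difference_relation A f e X"
  using assms by (auto simp: difference_relation_def)

lemma difference_relationE:
  assumes "(a, b) \<in> difference_relation A f e X"
  obtains x where "a \<in> A" "b \<in> A" "x \<in> X" "f a e = f x b"
  using assms by (auto simp: difference_relation_def)

text \<open>The unit law of the monoid is \<open>m x e = x = m e y\<close>; writing the summands of \<open>x \<oplus> y\<close> in this form and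
  applying interchange twice, with commutativity of \<open>\<oplus>\<close> in between, forces the value of \<open>m x y\<close>.\<close>

lemma (in ccm_magma) internal_monoid_product:
  assumes X: "subalgebra A (\<oplus>) X" and e: "e \<in> X"
    and m: "internal_monoid X (\<oplus>) e m" and x: "x \<in> X" and y: "y \<in> X"
  shows "m x y \<oplus> e = x \<oplus> y"
proof -
  interpret M: monoid "\<lparr>carrier = X, mult = m, one = e\<rparr>"
    using m by (simp add: internal_monoid_def)
  have interchange: "m p q \<oplus> m r s = m (p \<oplus> r) (q \<oplus> s)"
    if "p \<in> X" "q \<in> X" "r \<in> X" "s \<in> X" for p q r s
    using m that by (simp add: internal_monoid_def)
  have unit: "m z e = z" "m e z = z" if "z \<in> X" for z
    using that M.r_one[of z] M.l_one[of z] by simp_all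
  have "x \<oplus> y = m x e \<oplus> m e y"
    using x y by (simp add: unit)
  also have "\<dots> = m (x \<oplus> e) (e \<oplus> y)"
    using x y e by (simp add: interchange)
  also have "\<dots> = m (x \<oplus> e) (y \<oplus> e)"
    using X y e by (simp add: subalgebra_def subset_iff commute[of e y])
  also have "\<dots> = m x y \<oplus> m e e"
    using x y e by (simp add: interchange)
  finally show ?thesis
    using e by (simp add: unit)
qed

corollary (in ccm_magma) internal_monoid_unique:
  assumes X: "subalgebra A (\<oplus>) X" and e: "e \<in> X"
    and m: "internal_monoid X (\<oplus>) e m" and m': "internal_monoid X (\<oplus>) e m'"
    and x: "x \<in> X" and y: "y \<in> X"
  shows "m x y = m' x y"
proof (rule cancel)
  have "n x y \<in> X" if "internal_monoid X (\<oplus>) e n" for n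
  proof -
    interpret N: monoid "\<lparr>carrier = X, mult = n, one = e\<rparr>"
      using that by (simp add: internal_monoid_def)
    show ?thesis
      using N.m_closed[of x y] x y by simp
  qed
  then show "m x y \<in> A" "m' x y \<in> A"
    using X m m' by (auto simp: subalgebra_def)
  show "e \<in> A"
    using X e by (auto simp: subalgebra_def)
  show "m x y \<oplus> e = m' x y \<oplus> e"
    using internal_monoid_product[OF X e m x y] internal_monoid_product[OF X e m' x y] by simp
qed

locale ccm_magma_idempotent = ccm_magma +
  fixes X :: "'a set" and e :: 'a
  assumes subalgebra: "subalgebra A (\<oplus>) X"
    and e_mem: "e \<in> X"
    and idempotent: "e \<oplus> e = e"
begin

abbreviation (input) "R \<equiv> difference_relation A (\<oplus>) e X"

lemma mem_A [simp]: "x \<in> X \<Longrightarrow> x \<in> A"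
  using subalgebra by (auto simp: subalgebra_def)

lemma e_mem_A [simp]: "e \<in> A"
  using e_mem by simp

lemma translate_distrib:
  assumes "a \<in> A" "b \<in> A"
  shows "(a \<oplus> b) \<oplus> e = (a \<oplus> e) \<oplus> (b \<oplus> e)"
  using medial[OF assms, of e e] by (simp add: idempotent)

lemma internal_relation_difference: "internal_relation A (\<oplus>) R"
proof -
  have "(a \<oplus> c, b \<oplus> d) \<in> R" if "(a, b) \<in> R" "(c, d) \<in> R" for a b c d
  proof -
    from that obtain x y where ab: "a \<in> A" "b \<in> A" "x \<in> X" "a \<oplus> e = x \<oplus> b"
      and cd: "c \<in> A" "d \<in> A" "y \<in> X" "c \<oplus> e = y \<oplus> d"
      by (elim difference_relationE)
    have "(a \<oplus> c) \<oplus> e = (x \<oplus> b) \<oplus> (y \<oplus> d)"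
      using ab cd by (simp add: translate_distrib)
    also have "\<dots> = (x \<oplus> y) \<oplus> (b \<oplus> d)"
      using ab cd by (simp add: medial)
    finally show ?thesis
      using ab cd subalgebra
      by (intro difference_relationI[where x = "x \<oplus> y"]) (auto simp: subalgebra_def closed)
  qed
  moreover have "R \<subseteq> A \<times> A"
    by (auto simp: difference_relation_def)
  ultimately show ?thesis
    by (auto simp: internal_relation_def subalgebra_def componentwise_def)
qed

lemma refl_on_difference: "refl_on A R"
  by (intro refl_onI difference_relationI[where x = e]) (auto simp: e_mem commute)

text \<open>If \<open>x\<close> and \<open>y\<close> are the differences \<open>a - b\<close> and \<open>b - c\<close>, their sum \<open>z\<close> is the
  difference \<open>a - c\<close>.\<close>

lemma difference_trans:
  assumes mem: "a \<in> A" "b \<in> A" "c \<in> A" "x \<in> A" "y \<in> A" "z \<in> A"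
    and ab: "a \<oplus> e = x \<oplus> b" and bc: "b \<oplus> e = y \<oplus> c" and z: "z \<oplus> e = x \<oplus> y"
  shows "a \<oplus> e = z \<oplus> c"
proof (rule cancel)
  have "(a \<oplus> e) \<oplus> e = (x \<oplus> e) \<oplus> (b \<oplus> e)"
    unfolding ab using mem by (simp add: translate_distrib)
  also have "\<dots> = (x \<oplus> y) \<oplus> (e \<oplus> c)"
    unfolding bc using mem by (simp add: medial)
  also have "\<dots> = (z \<oplus> e) \<oplus> (c \<oplus> e)"
    using mem by (simp add: z commute)
  finally show "(a \<oplus> e) \<oplus> e = (z \<oplus> c) \<oplus> e"
    using mem by (simp add: translate_distrib)
qed (use mem in \<open>simp_all add: closed\<close>)

lemma trans_difference:
  assumes m: "internal_monoid X (\<oplus>) e m"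
  shows "trans R"
proof (rule transI)
  fix a b c assume "(a, b) \<in> R" "(b, c) \<in> R"
  then obtain x y where mem: "a \<in> A" "b \<in> A" "c \<in> A" "x \<in> X" "y \<in> X"
    and eqs: "a \<oplus> e = x \<oplus> b" "b \<oplus> e = y \<oplus> c"
    by (elim difference_relationE)
  interpret M: monoid "\<lparr>carrier = X, mult = m, one = e\<rparr>"
    using m by (simp add: internal_monoid_def)
  have z: "m x y \<in> X"
    using M.m_closed[of x y] mem by simp
  have "m x y \<oplus> e = x \<oplus> y"
    using internal_monoid_product[OF subalgebra e_mem m] mem by simp
  then have "a \<oplus> e = m x y \<oplus> c"
    using mem z eqs by (intro difference_trans[of a b c x y]) simp_all
  then show "(a, c) \<in> R"
    using mem z by (intro difference_relationI)
qed

text \<open>If \<open>x\<close> is the difference \<open>a - b\<close>, its negative \<open>z\<close> is the difference \<open>b - a\<close>.\<close>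

lemma difference_sym:
  assumes mem: "a \<in> A" "b \<in> A" "x \<in> A" "z \<in> A"
    and ab: "a \<oplus> e = x \<oplus> b" and z: "z \<oplus> x = e"
  shows "b \<oplus> e = z \<oplus> a"
proof (rule cancel)
  have "(z \<oplus> a) \<oplus> e = (z \<oplus> e) \<oplus> (x \<oplus> b)"
    using mem by (simp add: translate_distrib ab)
  also have "\<dots> = (z \<oplus> x) \<oplus> (e \<oplus> b)"
    using mem by (simp add: medial)
  also have "\<dots> = (b \<oplus> e) \<oplus> e"
    using mem by (simp add: z commute closed)
  finally show "(b \<oplus> e) \<oplus> e = (z \<oplus> a) \<oplus> e" ..
qed (use mem in \<open>simp_all add: closed\<close>)

lemma sym_difference_iff: "sym R \<longleftrightarrow> e_symmetric X (\<oplus>) e"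
proof
  assume sym: "sym R"
  show "e_symmetric X (\<oplus>) e"
    unfolding e_symmetric_def
  proof
    fix a assume a: "a \<in> X"
    then have "(a, e) \<in> R"
      by (intro difference_relationI[where x = a]) simp_all
    then have "(e, a) \<in> R"
      using sym by (blast dest: symD)
    then show "\<exists>b\<in>X. b \<oplus> a = e"
      by (metis difference_relationE idempotent)
  qed
next
  assume neg: "e_symmetric X (\<oplus>) e"
  show "sym R"
  proof (rule symI)
    fix a b assume "(a, b) \<in> R"
    then obtain x where mem: "a \<in> A" "b \<in> A" "x \<in> X" and ab: "a \<oplus> e = x \<oplus> b"
      by (elim difference_relationE)
    obtain z where z: "z \<in> X" "z \<oplus> x = e"
      using neg mem by (auto simp: e_symmetric_def)
    have "b \<oplus> e = z \<oplus> a"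
      using mem ab z by (intro difference_sym[of a b x]) simp_all
    then show "(b, a) \<in> R"
      using mem z by (intro difference_relationI)
  qed
qed

end

theorem proposition6p3:
  fixes A X :: "'a set" and oplus :: "'a \<Rightarrow> 'a \<Rightarrow> 'a" (infixl \<open>\<oplus>\<close> 65)
    and e :: 'a and R :: "('a \<times> 'a) set"
  assumes "ccm_magma A (\<oplus>)"
    and "subalgebra A (\<oplus>) X"
    and "e \<in> X"
    and "e \<oplus> e = e"
    and "R = {(a, b). a \<in> A \<and> b \<in> A \<and> (\<exists>x\<in>X. a \<oplus> e = x \<oplus> b)}"
  shows "internal_relation A (\<oplus>) R \<and>
    refl_on A R \<and>
    ((\<exists>m. internal_monoid X (\<oplus>) e m) \<longrightarrow> trans R) \<and>
    (\<forall>m m'. internal_monoid X (\<oplus>) e m \<and> internal_monoid X (\<oplus>) e m' \<longrightarrow>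
      (\<forall>x\<in>X. \<forall>y\<in>X. m x y = m' x y)) \<and>
    (sym R \<longleftrightarrow> e_symmetric X (\<oplus>) e)"
proof -
  interpret ccm_magma_idempotent A "(\<oplus>)" X e
    using assms(1-4)
    by (simp add: ccm_magma_idempotent_def ccm_magma_idempotent_axioms_def)
  have "R = difference_relation A (\<oplus>) e X"
    by (simp add: assms(5) difference_relation_def)
  then show ?thesis
    using internal_relation_difference refl_on_difference trans_difference
      internal_monoid_unique[OF subalgebra e_mem] sym_difference_iff
    by blast
qed

end
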